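(* Let $m>0$ and $L\in SV$. (A) Let $\xi,\eta$ be random variables belonging to the space $EL_m$ (with the function $L$), and let $\tau=\xi\eta$. Then there is a constant $C\in(0,\infty)$ such that for $x\ge2$ $$\mathbf P(|\tau|>x)\le\exp\bigl(-Cx^{m/2}L(\sqrt x)\bigr).$$ (B) Conversely, assume that the random variables $\xi,\eta$ are independent, identically and symmetrically distributed, and that there are constants $0<C_1<C_2<\infty$ such that for all $x\ge2$ $$\exp\bigl(-C_2x^mL(x)\bigr)\le\mathbf P(|\xi|>x)=\mathbf P(|\eta|>x)\le\exp\bigl(-C_1x^mL(x)\bigr).$$ Then, with $\tau=\xi\eta$, there is a constant $C_3\in(0,\infty)$ such that for all $x\ge2$ $$\mathbf P(|\tau|>x)\ge\exp\bigl(-C_3x^{m/2}L(\sqrt x)\bigr).$$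
   Context: Random variables are defined on a probability space $(\Omega,F,\mathbf P)$ with expectation $\mathbf E$. For $m>0$, $SV_m$ is the set of all continuous functions $L:[0,\infty)\to(0,\infty)$, slowly varying at infinity, such that $L(0)>0$, $u^mL(u)\uparrow\infty$ as $u\uparrow\infty$, and $\lim_{u\to\infty}L(u/L(u))/L(u)=1$; $SV=\bigcup_{m>0}SV_m$. The space $EL_m$ with function $L$ is the Orlicz space of random variables $\eta$ with $\inf_{v>0}v^{-1}(1+\mathbf E N(v\eta))<\infty$, where $N$ is an even function with $N(u)=\exp(W(\log u))$ for $u\ge e^2$, $W(\log u)=u^mL(u)$ (so $N(u)=\exp(u^mL(u))$ for $u\ge e^2$); on $[0,e^2)$ $N$ is defined arbitrarily but so that $N$ is continuous, convex, strictly increasing on $[0,\infty)$ and $N(u)\sim \mathrm{const}\cdot u^2$ as $u\to0+$ with a positive constant. As for all spaces of this type in the paper, $W$ is assumed continuous, strictly increasing and convex on $[2,\infty)$ with left derivative tending to infinity.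
   Formalization: Part (A) fails as written (ξ=η=10 gives P(|τ|>2)=1), so the bound for all x≥2 is proved under the necessary extra hypothesis P(|τ|>2)<1; without it, the same bound is proved for all x≥x0 for some x0≥2. *)

theory Defs
  imports "HOL-Probability.Probability"
begin

definition slowly_varying :: "(real \<Rightarrow> real) \<Rightarrow> bool" where
  "slowly_varying L \<longleftrightarrow> (\<forall>c>0. ((\<lambda>u. L (c * u) / L u) \<longlongrightarrow> 1) at_top)"

text \<open>Functions on the half-line are total functions whose values at negative arguments are
  irrelevant.\<close>

definition SV_index :: "real \<Rightarrow> (real \<Rightarrow> real) set" where
  "SV_index m = {L. continuous_on {0..} L \<and> (\<forall>u\<ge>0. L u > 0) \<and> slowly_varying L \<and>
     mono_on {0..} (\<lambda>u. u powr m * L u) \<and> filterlim (\<lambda>u. u powr m * L u) at_top at_top \<and>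
     ((\<lambda>u. L (u / L u) / L u) \<longlongrightarrow> 1) at_top}"

definition SV :: "(real \<Rightarrow> real) set" where
  "SV = (\<Union>m\<in>{0<..}. SV_index m)"

text \<open>The function \<open>W\<close> with \<open>W (ln u) = u powr m * L u\<close>.\<close>

definition EL_weight :: "real \<Rightarrow> (real \<Rightarrow> real) \<Rightarrow> real \<Rightarrow> real" where
  "EL_weight m L z = exp z powr m * L (exp z)"

definition admissible_weight :: "(real \<Rightarrow> real) \<Rightarrow> bool" where
  "admissible_weight W \<longleftrightarrow>
     continuous_on {2..} W \<and> strict_mono_on {2..} W \<and> convex_on {2..} W \<and>
     (\<exists>D. (\<forall>z>2. (W has_real_derivative D z) (at_left z)) \<and> filterlim D at_top at_top)"

text \<open>\<open>N\<close> is one of the admissible choices of the Young function: below \<open>(exp 1)\<^sup>2\<close> it is only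
  restricted qualitatively.\<close>

definition EL_young :: "real \<Rightarrow> (real \<Rightarrow> real) \<Rightarrow> (real \<Rightarrow> real) \<Rightarrow> bool" where
  "EL_young m L N \<longleftrightarrow>
     admissible_weight (EL_weight m L) \<and>
     (\<forall>u. N (- u) = N u) \<and>
     (\<forall>u\<ge>exp 2. N u = exp (EL_weight m L (ln u))) \<and>
     continuous_on {0..} N \<and> convex_on {0..} N \<and> strict_mono_on {0..} N \<and>
     (\<exists>c>0. N \<sim>[at_right 0] (\<lambda>u. c * u\<^sup>2))"

text \<open>Such an \<open>N\<close> is nonnegative, as \<open>N 0 = 0\<close>, so the expectation below is the
  \<open>[0,\<infinity>]\<close>-valued one and \<open>ennreal\<close> truncates nothing.\<close>

definition Orlicz_norm :: "'a measure \<Rightarrow> (real \<Rightarrow> real) \<Rightarrow> ('a \<Rightarrow> real) \<Rightarrow> ennreal" where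
  "Orlicz_norm M N \<eta> =
     (INF v\<in>{0<..}. ennreal (inverse v) * (1 + (\<integral>\<^sup>+\<omega>. ennreal (N (v * \<eta> \<omega>)) \<partial>M)))"

definition Orlicz_space :: "'a measure \<Rightarrow> (real \<Rightarrow> real) \<Rightarrow> ('a \<Rightarrow> real) set" where
  "Orlicz_space M N = {\<eta> \<in> borel_measurable M. Orlicz_norm M N \<eta> < \<infinity>}"

end

theory Submission imports Defs "HOL-Real_Asymp.Real_Asymp" begin

text \<open>Since \<open>\<bar>\<xi> \<eta>\<bar> > x\<close> forces \<open>\<bar>\<xi>\<bar> > sqrt x\<close> or \<open>\<bar>\<eta>\<bar> > sqrt x\<close>, and follows from both
  together, the tail of the product is governed by the tails of the factors at \<open>sqrt x\<close>. In (A) these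
  are estimated by Markov's inequality for \<open>N (v * \<xi>)\<close>, the scale \<open>v\<close> being absorbed by slow variation;
  in (B) independence multiplies the lower bounds. On bounded ranges of \<open>x\<close> the function
  \<open>x powr (m / 2) * L (sqrt x)\<close> is bounded away from \<open>0\<close> and \<open>\<infinity>\<close>, so only the constant changes.\<close>

lemma EL_weight_ln: "u > 0 \<Longrightarrow> EL_weight m L (ln u) = u powr m * L u"
  by (simp add: EL_weight_def)

lemma SV_D:
  assumes "L \<in> SV"
  shows "continuous_on {0..} L" "slowly_varying L" "\<And>u. u \<ge> 0 \<Longrightarrow> L u > 0"
  using assms by (auto simp: SV_def SV_index_def)

lemma continuous_on_powr_mult_sqrt:
  assumes "continuous_on {0..} L" "a > 0"
  shows "continuous_on {a..b} (\<lambda>x. x powr (m / 2) * L (sqrt x))"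
proof -
  have "continuous_on {a..b} (\<lambda>x. L (sqrt x))"
    using assms(2) by (intro continuous_on_compose2[OF assms(1)]) (auto intro!: continuous_intros)
  then show ?thesis
    using assms by (intro continuous_intros) auto
qed

lemma sqrt_powr_mult: "x \<ge> 0 \<Longrightarrow> sqrt x powr m * l = x powr (m / 2) * (l :: real)"
  by (simp add: powr_half_sqrt [symmetric] powr_powr)

lemma filterlim_strict_mono_convex_at_top:
  fixes W :: "real \<Rightarrow> real"
  assumes mono: "strict_mono_on {a..} W" and conv: "convex_on {a..} W"
  shows "filterlim W at_top at_top"
proof -
  define d where "d = W (a + 1) - W a"
  have d: "d > 0"
    using mono by (auto simp: d_def strict_mono_on_def)
  have *: "W a + (z - a) * d \<le> W z" if z: "z > a + 1" for z
  proof -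
    define t where "t = 1 / (z - a)"
    have t: "0 < t" "t < 1" and tz: "t * (z - a) = 1"
      using z by (auto simp: t_def)
    have "W ((1 - t) * a + t * z) \<le> (1 - t) * W a + t * W z"
      using convex_onD[OF conv, of t a z] t z by auto
    moreover have "(1 - t) * a + t * z = a + 1"
      using tz by (simp add: algebra_simps)
    ultimately have "d \<le> t * (W z - W a)"
      by (simp add: d_def algebra_simps)
    then have "(z - a) * d \<le> (z - a) * (t * (W z - W a))"
      using z by (intro mult_left_mono) auto
    also have "\<dots> = W z - W a"
      using tz by (metis mult.assoc mult.commute mult_1)
    finally show ?thesis by simp
  qed
  have "filterlim (\<lambda>z. W a + (z - a) * d) at_top at_top"
    using d by real_asymp
  then show ?thesis
    by (rule filterlim_at_top_mono)
      (use * in \<open>auto intro: eventually_mono[OF eventually_gt_at_top[of "a + 1"]]\<close>)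
qed

lemma admissible_weight_at_top:
  "admissible_weight W \<Longrightarrow> filterlim W at_top at_top"
  by (auto simp: admissible_weight_def intro: filterlim_strict_mono_convex_at_top)

lemma Orlicz_spaceE:
  assumes "\<eta> \<in> Orlicz_space M N"
  obtains v where "v > 0" "(\<integral>\<^sup>+\<omega>. ennreal (N (v * \<eta> \<omega>)) \<partial>M) < \<infinity>"
proof -
  obtain v where v: "v > 0"
    "ennreal (inverse v) * (1 + (\<integral>\<^sup>+\<omega>. ennreal (N (v * \<eta> \<omega>)) \<partial>M)) < \<infinity>"
    using assms by (auto simp: Orlicz_space_def Orlicz_norm_def INF_less_iff)
  then have "(\<integral>\<^sup>+\<omega>. ennreal (N (v * \<eta> \<omega>)) \<partial>M) < \<infinity>"
    by (auto simp: ennreal_mult_less_top)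
  with v show ?thesis by (intro that)
qed

lemma (in prob_space) Orlicz_space_Markov:
  assumes \<eta>: "\<eta> \<in> Orlicz_space M N"
    and even: "\<And>u. N (- u) = N u" and mono: "strict_mono_on {0..} N"
  obtains v K where "v > 0" "K > 0" "\<And>u. u \<ge> 0 \<Longrightarrow> \<P>(\<omega> in M. \<bar>\<eta> \<omega>\<bar> > u) * N (v * u) \<le> K"
proof -
  have [measurable]: "\<eta> \<in> borel_measurable M"
    using \<eta> by (simp add: Orlicz_space_def)
  obtain v where v: "v > 0" "(\<integral>\<^sup>+\<omega>. ennreal (N (v * \<eta> \<omega>)) \<partial>M) < \<infinity>"
    using Orlicz_spaceE[OF \<eta>] .
  define J where "J = (\<integral>\<^sup>+\<omega>. ennreal (N (v * \<eta> \<omega>)) \<partial>M)"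
  have J: "J < \<infinity>" using v by (simp add: J_def)
  have "\<P>(\<omega> in M. \<bar>\<eta> \<omega>\<bar> > u) * N (v * u) \<le> enn2real J + 1" if u: "u \<ge> 0" for u
  proof -
    let ?A = "{\<omega> \<in> space M. \<bar>\<eta> \<omega>\<bar> > u}"
    have le: "N (v * u) \<le> N (v * \<eta> \<omega>)" if "\<bar>\<eta> \<omega>\<bar> > u" for \<omega>
    proof -
      have "N (v * u) \<le> N (v * \<bar>\<eta> \<omega>\<bar>)"
        using v u that by (intro strict_mono_onD[OF mono, THEN less_imp_le]) auto
      also have "\<dots> = N (v * \<eta> \<omega>)"
        using even[of "v * \<eta> \<omega>"] by (cases "\<eta> \<omega> \<ge> 0") auto
      finally show ?thesis .
    qed
    have "ennreal (N (v * u)) * emeasure M ?A = (\<integral>\<^sup>+\<omega>. ennreal (N (v * u)) * indicator ?A \<omega> \<partial>M)"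
      by (subst nn_integral_cmult_indicator) auto
    also have "\<dots> \<le> J"
      unfolding J_def by (intro nn_integral_mono) (auto simp: indicator_def intro!: ennreal_leI le)
    finally have "ennreal (N (v * u) * prob ?A) \<le> ennreal (enn2real J)"
      using J by (simp add: emeasure_eq_measure ennreal_mult'')
    then have "N (v * u) * prob ?A \<le> enn2real J"
      by (subst (asm) ennreal_le_iff) auto
    then show ?thesis by (simp add: mult.commute)
  qed
  moreover have "enn2real J + 1 > 0"
    by (simp add: add_nonneg_pos)
  ultimately show ?thesis using v(1) by (intro that)
qed

lemma (in prob_space) Orlicz_space_tail:
  assumes N: "EL_young m L N" and L: "L \<in> SV" and \<eta>: "\<eta> \<in> Orlicz_space M N"
  shows "\<exists>c>0. \<forall>\<^sub>F u in at_top. \<P>(\<omega> in M. \<bar>\<eta> \<omega>\<bar> > u) \<le> exp (- c * (u powr m * L u)) / 2"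
proof -
  have even: "\<And>u. N (- u) = N u" and mono: "strict_mono_on {0..} N"
    and adm: "admissible_weight (EL_weight m L)"
    and Nexp: "\<And>u. u \<ge> exp 2 \<Longrightarrow> N u = exp (EL_weight m L (ln u))"
    using N by (auto simp: EL_young_def)
  obtain v K where v: "v > 0" and K: "K > 0"
    and bd: "\<And>u. u \<ge> 0 \<Longrightarrow> \<P>(\<omega> in M. \<bar>\<eta> \<omega>\<bar> > u) * N (v * u) \<le> K"
    using Orlicz_space_Markov[OF \<eta> even mono] by metis
  define A where "A u = EL_weight m L (ln (v * u))" for u
  have limv: "filterlim (\<lambda>u. v * u) at_top at_top"
    using v by real_asymp
  have "filterlim A at_top at_top"
    unfolding A_def
    by (rule filterlim_compose[OF admissible_weight_at_top[OF adm]
          filterlim_compose[OF ln_at_top limv]])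
  then have ev1: "\<forall>\<^sub>F u in at_top. 2 * ln (2 * K) \<le> A u"
    by (auto simp: filterlim_at_top)
  have ev2: "\<forall>\<^sub>F u in at_top. exp 2 \<le> v * u"
    using limv by (auto simp: filterlim_at_top)
  have "((\<lambda>u. L (v * u) / L u) \<longlongrightarrow> 1) at_top"
    using SV_D(2)[OF L] v by (auto simp: slowly_varying_def)
  then have ev3: "\<forall>\<^sub>F u in at_top. 1 / 2 < L (v * u) / L u"
    by (rule order_tendstoD) simp
  have "\<forall>\<^sub>F u in at_top. \<P>(\<omega> in M. \<bar>\<eta> \<omega>\<bar> > u) \<le> exp (- (v powr m / 4) * (u powr m * L u)) / 2"
    using ev1 ev2 ev3 eventually_gt_at_top[of 0]
  proof eventually_elim
    case (elim u)
    have Lu: "L u > 0" using SV_D(3)[OF L, of u] elim by simp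
    have A: "A u = v powr m * u powr m * L (v * u)"
      using v elim by (simp add: A_def EL_weight_ln powr_mult)
    have "L u / 2 \<le> L (v * u)"
      using elim(3) Lu by (simp add: field_simps)
    then have "v powr m * u powr m * (L u / 2) \<le> A u"
      unfolding A by (intro mult_left_mono) auto
    then have *: "- (A u / 2) \<le> - (v powr m / 4) * (u powr m * L u)"
      by (simp add: algebra_simps)
    have "\<P>(\<omega> in M. \<bar>\<eta> \<omega>\<bar> > u) * exp (A u) \<le> K"
      using bd[of u] Nexp[of "v * u"] elim by (simp add: A_def)
    then have "\<P>(\<omega> in M. \<bar>\<eta> \<omega>\<bar> > u) \<le> K * exp (- A u)"
      by (simp add: exp_minus field_simps)
    also have "\<dots> = K * exp (- (A u / 2)) * exp (- (A u / 2))"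
      by (simp add: mult.assoc flip: exp_add)
    also have "\<dots> \<le> K * exp (- ln (2 * K)) * exp (- (A u / 2))"
      using elim(1) K by (intro mult_left_mono mult_right_mono) auto
    also have "\<dots> = exp (- (A u / 2)) / 2"
      using K by (simp add: exp_minus)
    also have "\<dots> \<le> exp (- (v powr m / 4) * (u powr m * L u)) / 2"
      using * by (intro divide_right_mono) (subst exp_le_cancel_iff, auto)
    finally show ?case .
  qed
  moreover have "v powr m / 4 > 0" using v by simp
  ultimately show ?thesis by blast
qed

lemma (in prob_space) prob_abs_mult_gt_le:
  assumes [measurable]: "\<xi> \<in> borel_measurable M" "\<eta> \<in> borel_measurable M" and "x \<ge> 0"
  shows "\<P>(\<omega> in M. \<bar>\<xi> \<omega> * \<eta> \<omega>\<bar> > x) \<le>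
    \<P>(\<omega> in M. \<bar>\<xi> \<omega>\<bar> > sqrt x) + \<P>(\<omega> in M. \<bar>\<eta> \<omega>\<bar> > sqrt x)"
proof -
  have "\<bar>a\<bar> > sqrt x \<or> \<bar>b\<bar> > sqrt x" if "\<bar>a * b\<bar> > x" for a b
  proof (rule ccontr)
    assume "\<not> ?thesis"
    then have "\<bar>a\<bar> * \<bar>b\<bar> \<le> sqrt x * sqrt x"
      using assms by (intro mult_mono) auto
    with that assms show False by (simp add: abs_mult)
  qed
  then have "\<P>(\<omega> in M. \<bar>\<xi> \<omega> * \<eta> \<omega>\<bar> > x) \<le>
      prob ({\<omega> \<in> space M. \<bar>\<xi> \<omega>\<bar> > sqrt x} \<union> {\<omega> \<in> space M. \<bar>\<eta> \<omega>\<bar> > sqrt x})"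
    by (intro finite_measure_mono) auto
  also have "\<dots> \<le> \<P>(\<omega> in M. \<bar>\<xi> \<omega>\<bar> > sqrt x) + \<P>(\<omega> in M. \<bar>\<eta> \<omega>\<bar> > sqrt x)"
    by (intro measure_Un_le) auto
  finally show ?thesis .
qed

lemma (in prob_space) prob_abs_mult_gt_ge:
  assumes indep: "indep_var borel \<xi> borel \<eta>" and "x \<ge> 0"
  shows "\<P>(\<omega> in M. \<bar>\<xi> \<omega>\<bar> > sqrt x) * \<P>(\<omega> in M. \<bar>\<eta> \<omega>\<bar> > sqrt x) \<le>
    \<P>(\<omega> in M. \<bar>\<xi> \<omega> * \<eta> \<omega>\<bar> > x)"
proof -
  have [measurable]: "\<xi> \<in> borel_measurable M" "\<eta> \<in> borel_measurable M"
    using indep_var_rv1[OF indep] indep_var_rv2[OF indep] by auto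
  let ?B = "{y :: real. \<bar>y\<bar> > sqrt x}"
  have B: "?B \<in> sets borel" by measurable
  have "prob (\<xi> -` ?B \<inter> space M) * prob (\<eta> -` ?B \<inter> space M) =
      prob ((\<lambda>\<omega>. (\<xi> \<omega>, \<eta> \<omega>)) -` (?B \<times> ?B) \<inter> space M)"
    using indep_varD[OF indep B B] by simp
  also have "\<dots> \<le> \<P>(\<omega> in M. \<bar>\<xi> \<omega> * \<eta> \<omega>\<bar> > x)"
  proof (intro finite_measure_mono subsetI)
    fix \<omega> assume "\<omega> \<in> (\<lambda>\<omega>. (\<xi> \<omega>, \<eta> \<omega>)) -` (?B \<times> ?B) \<inter> space M"
    then have "sqrt x * sqrt x < \<bar>\<xi> \<omega>\<bar> * \<bar>\<eta> \<omega>\<bar>" "\<omega> \<in> space M"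
      using assms(2) by (auto intro!: mult_strict_mono' simp del: real_sqrt_mult_self)
    then show "\<omega> \<in> {\<omega> \<in> space M. \<bar>\<xi> \<omega> * \<eta> \<omega>\<bar> > x}"
      using assms(2) by (simp add: abs_mult)
  qed auto
  finally show ?thesis
    by (simp add: vimage_def Int_def conj_commute)
qed

lemma (in prob_space) product_tail_upper:
  assumes N: "EL_young m L N" and L: "L \<in> SV"
    and \<xi>: "\<xi> \<in> Orlicz_space M N" and \<eta>: "\<eta> \<in> Orlicz_space M N"
  shows "\<exists>C>0. \<exists>x0\<ge>2. \<forall>x\<ge>x0.
    \<P>(\<omega> in M. \<bar>\<xi> \<omega> * \<eta> \<omega>\<bar> > x) \<le> exp (- C * x powr (m / 2) * L (sqrt x))"
proof -
  obtain c where c: "c > 0"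
    "\<forall>\<^sub>F u in at_top. \<P>(\<omega> in M. \<bar>\<xi> \<omega>\<bar> > u) \<le> exp (- c * (u powr m * L u)) / 2"
    using Orlicz_space_tail[OF N L \<xi>] by blast
  obtain d where d: "d > 0"
    "\<forall>\<^sub>F u in at_top. \<P>(\<omega> in M. \<bar>\<eta> \<omega>\<bar> > u) \<le> exp (- d * (u powr m * L u)) / 2"
    using Orlicz_space_tail[OF N L \<eta>] by blast
  have meas: "\<xi> \<in> borel_measurable M" "\<eta> \<in> borel_measurable M"
    using \<xi> \<eta> by (auto simp: Orlicz_space_def)
  have "\<forall>\<^sub>F x in at_top.
      \<P>(\<omega> in M. \<bar>\<xi> \<omega> * \<eta> \<omega>\<bar> > x) \<le> exp (- min c d * x powr (m / 2) * L (sqrt x))"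
    using filterlim_iff[THEN iffD1, OF sqrt_at_top, rule_format, OF c(2)]
      filterlim_iff[THEN iffD1, OF sqrt_at_top, rule_format, OF d(2)]
      eventually_ge_at_top[of 0]
  proof eventually_elim
    case (elim x)
    let ?g = "x powr (m / 2) * L (sqrt x)"
    have g: "?g \<ge> 0" using SV_D(3)[OF L, of "sqrt x"] elim by simp
    have "\<P>(\<omega> in M. \<bar>\<xi> \<omega> * \<eta> \<omega>\<bar> > x) \<le> exp (- c * ?g) / 2 + exp (- d * ?g) / 2"
      using prob_abs_mult_gt_le[OF meas, of x] elim by (simp add: sqrt_powr_mult)
    also have "\<dots> \<le> exp (- min c d * ?g) / 2 + exp (- min c d * ?g) / 2"
      using g by (intro add_mono divide_right_mono) (auto intro: mult_right_mono)
    finally show ?case by (simp add: mult.assoc)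
  qed
  then obtain x0 where
    "\<forall>x\<ge>x0. \<P>(\<omega> in M. \<bar>\<xi> \<omega> * \<eta> \<omega>\<bar> > x) \<le> exp (- min c d * x powr (m / 2) * L (sqrt x))"
    by (auto simp: eventually_at_top_linorder)
  then show ?thesis
    using c d by (intro exI[of _ "min c d"] conjI exI[of _ "max x0 2"]) auto
qed

lemma upper_bound_extend:
  fixes p g :: "real \<Rightarrow> real"
  assumes tail: "\<exists>C>0. \<exists>x0\<ge>a. \<forall>x\<ge>x0. p x \<le> exp (- C * g x)"
    and anti: "\<And>x. x \<ge> a \<Longrightarrow> p x \<le> p a" and pa: "p a < 1"
    and g: "\<And>x. x \<ge> a \<Longrightarrow> g x \<ge> 0" and cont: "\<And>b. continuous_on {a..b} g"
  shows "\<exists>C>0. \<forall>x\<ge>a. p x \<le> exp (- C * g x)"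
proof -
  obtain C x0 where C: "C > 0" "x0 \<ge> a" "\<And>x. x \<ge> x0 \<Longrightarrow> p x \<le> exp (- C * g x)"
    using tail by blast
  obtain B where B: "\<And>x. x \<in> {a..x0} \<Longrightarrow> g x \<le> B"
    using continuous_attains_sup[of "{a..x0}" g] cont C(2)
    by (metis atLeastAtMost_iff compact_Icc empty_iff order_refl)
  define q where "q = max (p a) (1 / 2)"
  define B' where "B' = max B 1"
  define D where "D = min C (- ln q / B')"
  have q: "0 < q" "q < 1" using pa by (auto simp: q_def)
  have B': "B' > 0" by (simp add: B'_def)
  have D: "D > 0" using q B' C by (simp add: D_def divide_neg_pos)
  have "p x \<le> exp (- D * g x)" if x: "x \<ge> a" for x
  proof (cases "x \<ge> x0")
    case True
    have "D * g x \<le> C * g x"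
      using g[OF x] by (intro mult_right_mono) (auto simp: D_def)
    then have "exp (- C * g x) \<le> exp (- D * g x)" by simp
    with C(3)[OF True] show ?thesis by linarith
  next
    case False
    have "D * g x \<le> D * B'"
      using B[of x] x False D by (intro mult_left_mono) (auto simp: B'_def)
    also have "\<dots> \<le> (- ln q / B') * B'"
      using B' by (intro mult_right_mono) (auto simp: D_def)
    also have "\<dots> = - ln q" using B' by simp
    finally have "exp (ln q) \<le> exp (- D * g x)" by simp
    moreover have "p x \<le> q" using anti[OF x] by (simp add: q_def)
    ultimately show ?thesis using q by simp
  qed
  with D show ?thesis by blast
qed

lemma lower_bound_extend:
  fixes p g :: "real \<Rightarrow> real"
  assumes tail: "\<And>x. x \<ge> b \<Longrightarrow> p x \<ge> exp (- C * g x)"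
    and anti: "\<And>x. x \<le> b \<Longrightarrow> p b \<le> p x" and "a \<le> b"
    and g: "\<And>x. x \<ge> a \<Longrightarrow> g x > 0" and cont: "continuous_on {a..b} g"
  shows "\<exists>C>0. \<forall>x\<ge>a. p x \<ge> exp (- C * g x)"
proof -
  obtain y where y: "y \<in> {a..b}" "\<And>x. x \<in> {a..b} \<Longrightarrow> g y \<le> g x"
    using continuous_attains_inf[of "{a..b}" g] cont \<open>a \<le> b\<close> by auto
  have gy: "g y > 0" and gb: "g b > 0" using g y(1) \<open>a \<le> b\<close> by auto
  define D where "D = max 1 (max C (C * g b / g y))"
  have D: "D \<ge> 1" "D \<ge> C" by (auto simp: D_def)
  have "p x \<ge> exp (- D * g x)" if x: "x \<ge> a" for x
  proof (cases "x \<ge> b")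
    case True
    have "C * g x \<le> D * g x"
      using g[OF x] D by (intro mult_right_mono) auto
    then have "exp (- D * g x) \<le> exp (- C * g x)" by simp
    with tail[OF True] show ?thesis by linarith
  next
    case False
    have "C * g b = (C * g b / g y) * g y" using gy by simp
    also have "\<dots> \<le> D * g y"
      using gy by (intro mult_right_mono) (auto simp: D_def)
    also have "\<dots> \<le> D * g x"
      using y(2)[of x] x False D by (intro mult_left_mono) auto
    finally have "exp (- D * g x) \<le> exp (- C * g b)" by simp
    also have "\<dots> \<le> p b" by (rule tail) simp
    also have "\<dots> \<le> p x" using False by (intro anti) auto
    finally show ?thesis .
  qed
  moreover have "D > 0" using D by simp
  ultimately show ?thesis by blast
qed

lemma (in prob_space) prob_abs_gt_antimono:
  assumes [measurable]: "X \<in> borel_measurable M" and "x \<le> y"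
  shows "\<P>(\<omega> in M. \<bar>X \<omega> :: real\<bar> > y) \<le> \<P>(\<omega> in M. \<bar>X \<omega>\<bar> > x)"
  using assms(2) by (intro finite_measure_mono) auto

theorem theorem7:
  fixes M :: "'a measure" and m :: real and L :: "real \<Rightarrow> real"
  assumes "prob_space M" and "m > 0" and "L \<in> SV"
  shows
    "(\<forall>N \<xi> \<eta>. EL_young m L N \<longrightarrow> \<xi> \<in> Orlicz_space M N \<longrightarrow> \<eta> \<in> Orlicz_space M N \<longrightarrow>
       (\<P>(\<omega> in M. \<bar>\<xi> \<omega> * \<eta> \<omega>\<bar> > 2) < 1 \<longrightarrow>
         (\<exists>C>0. \<forall>x\<ge>2. \<P>(\<omega> in M. \<bar>\<xi> \<omega> * \<eta> \<omega>\<bar> > x) \<le> exp (- C * x powr (m / 2) * L (sqrt x)))) \<and>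
       (\<exists>C>0. \<exists>x0\<ge>2. \<forall>x\<ge>x0.
          \<P>(\<omega> in M. \<bar>\<xi> \<omega> * \<eta> \<omega>\<bar> > x) \<le> exp (- C * x powr (m / 2) * L (sqrt x)))) \<and>
     (\<forall>(\<xi> :: 'a \<Rightarrow> real) (\<eta> :: 'a \<Rightarrow> real) C1 C2.
       prob_space.indep_var M borel \<xi> borel \<eta> \<longrightarrow>
       distr M borel \<xi> = distr M borel \<eta> \<longrightarrow>
       distr M borel \<xi> = distr M borel (\<lambda>\<omega>. - \<xi> \<omega>) \<longrightarrow>
       0 < C1 \<longrightarrow> C1 < C2 \<longrightarrow>
       (\<forall>x\<ge>2. exp (- C2 * x powr m * L x) \<le> \<P>(\<omega> in M. \<bar>\<xi> \<omega>\<bar> > x) \<and>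
          \<P>(\<omega> in M. \<bar>\<xi> \<omega>\<bar> > x) = \<P>(\<omega> in M. \<bar>\<eta> \<omega>\<bar> > x) \<and>
          \<P>(\<omega> in M. \<bar>\<eta> \<omega>\<bar> > x) \<le> exp (- C1 * x powr m * L x)) \<longrightarrow>
       (\<exists>C3>0. \<forall>x\<ge>2. \<P>(\<omega> in M. \<bar>\<xi> \<omega> * \<eta> \<omega>\<bar> > x) \<ge> exp (- C3 * x powr (m / 2) * L (sqrt x))))"
proof -
  interpret prob_space M by fact
  note L = \<open>L \<in> SV\<close>
  let ?g = "\<lambda>x. x powr (m / 2) * L (sqrt x)"
  have g: "?g x > 0" if "x \<ge> 2" for x
    using SV_D(3)[OF L, of "sqrt x"] that by simp
  have cont: "continuous_on {2..b} ?g" for b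
    using SV_D(1)[OF L] by (rule continuous_on_powr_mult_sqrt) simp
  have A: "\<exists>C>0. \<forall>x\<ge>2. \<P>(\<omega> in M. \<bar>\<xi> \<omega> * \<eta> \<omega>\<bar> > x) \<le> exp (- C * ?g x)"
    if "EL_young m L N" "\<xi> \<in> Orlicz_space M N" "\<eta> \<in> Orlicz_space M N"
      and lt: "\<P>(\<omega> in M. \<bar>\<xi> \<omega> * \<eta> \<omega>\<bar> > 2) < 1" for N \<xi> \<eta>
  proof (rule upper_bound_extend[where g = ?g
      and p = "\<lambda>x. \<P>(\<omega> in M. \<bar>\<xi> \<omega> * \<eta> \<omega>\<bar> > x)", OF _ _ lt less_imp_le[OF g] cont])
    show "\<exists>C>0. \<exists>x0\<ge>2. \<forall>x\<ge>x0. \<P>(\<omega> in M. \<bar>\<xi> \<omega> * \<eta> \<omega>\<bar> > x) \<le> exp (- C * ?g x)"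
      using product_tail_upper[OF that(1) L that(2,3)] by (simp add: mult.assoc)
    have [measurable]: "\<xi> \<in> borel_measurable M" "\<eta> \<in> borel_measurable M"
      using that by (auto simp: Orlicz_space_def)
    show "\<P>(\<omega> in M. \<bar>\<xi> \<omega> * \<eta> \<omega>\<bar> > x) \<le> \<P>(\<omega> in M. \<bar>\<xi> \<omega> * \<eta> \<omega>\<bar> > 2)" if "x \<ge> 2" for x
      using that by (intro prob_abs_gt_antimono) auto
  qed
  have B: "\<exists>C>0. \<forall>x\<ge>2. \<P>(\<omega> in M. \<bar>\<xi> \<omega> * \<eta> \<omega>\<bar> > x) \<ge> exp (- C * ?g x)"
    if indep: "indep_var borel \<xi> borel \<eta>"
      and lower: "\<And>x. x \<ge> 2 \<Longrightarrow> exp (- C2 * x powr m * L x) \<le> \<P>(\<omega> in M. \<bar>\<xi> \<omega>\<bar> > x) \<and>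
        \<P>(\<omega> in M. \<bar>\<xi> \<omega>\<bar> > x) = \<P>(\<omega> in M. \<bar>\<eta> \<omega>\<bar> > x)" for \<xi> \<eta> C2
  proof (rule lower_bound_extend[where g = ?g
      and p = "\<lambda>x. \<P>(\<omega> in M. \<bar>\<xi> \<omega> * \<eta> \<omega>\<bar> > x)" and b = 4 and C = "2 * C2", OF _ _ _ g cont])
    fix x :: real
    have [measurable]: "\<xi> \<in> borel_measurable M" "\<eta> \<in> borel_measurable M"
      using indep_var_rv1[OF indep] indep_var_rv2[OF indep] by auto
    show "\<P>(\<omega> in M. \<bar>\<xi> \<omega> * \<eta> \<omega>\<bar> > 4) \<le> \<P>(\<omega> in M. \<bar>\<xi> \<omega> * \<eta> \<omega>\<bar> > x)" if "x \<le> 4"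
      using that by (intro prob_abs_gt_antimono) auto
    assume x: "x \<ge> 4"
    then have sx: "sqrt x \<ge> 2" by (simp add: real_le_rsqrt)
    have "exp (- (2 * C2) * ?g x) = exp (- C2 * ?g x) * exp (- C2 * ?g x)"
      by (simp flip: exp_add)
    also have "\<dots> \<le> \<P>(\<omega> in M. \<bar>\<xi> \<omega>\<bar> > sqrt x) * \<P>(\<omega> in M. \<bar>\<eta> \<omega>\<bar> > sqrt x)"
      using lower[OF sx] x by (intro mult_mono) (auto simp: sqrt_powr_mult mult.assoc)
    also have "\<dots> \<le> \<P>(\<omega> in M. \<bar>\<xi> \<omega> * \<eta> \<omega>\<bar> > x)"
      using x by (intro prob_abs_mult_gt_ge[OF indep]) auto
    finally show "\<P>(\<omega> in M. \<bar>\<xi> \<omega> * \<eta> \<omega>\<bar> > x) \<ge> exp (- (2 * C2) * ?g x)" .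
  qed auto
  show ?thesis
  proof (intro conjI allI impI)
    fix N \<xi> \<eta>
    assume "EL_young m L N" "\<xi> \<in> Orlicz_space M N" "\<eta> \<in> Orlicz_space M N"
      and "\<P>(\<omega> in M. \<bar>\<xi> \<omega> * \<eta> \<omega>\<bar> > 2) < 1"
    from A[OF this] show "\<exists>C>0. \<forall>x\<ge>2. \<P>(\<omega> in M. \<bar>\<xi> \<omega> * \<eta> \<omega>\<bar> > x)
        \<le> exp (- C * x powr (m / 2) * L (sqrt x))"
      by (simp only: mult.assoc)
  next
    fix N \<xi> \<eta>
    assume "EL_young m L N" "\<xi> \<in> Orlicz_space M N" "\<eta> \<in> Orlicz_space M N"
    then show "\<exists>C>0. \<exists>x0\<ge>2. \<forall>x\<ge>x0. \<P>(\<omega> in M. \<bar>\<xi> \<omega> * \<eta> \<omega>\<bar> > x)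
        \<le> exp (- C * x powr (m / 2) * L (sqrt x))"
      by (intro product_tail_upper[OF _ L])
  next
    fix \<xi> \<eta> :: "'a \<Rightarrow> real" and C1 C2 :: real
    assume indep: "indep_var borel \<xi> borel \<eta>"
      and bds: "\<forall>x\<ge>2. exp (- C2 * x powr m * L x) \<le> \<P>(\<omega> in M. \<bar>\<xi> \<omega>\<bar> > x) \<and>
          \<P>(\<omega> in M. \<bar>\<xi> \<omega>\<bar> > x) = \<P>(\<omega> in M. \<bar>\<eta> \<omega>\<bar> > x) \<and>
          \<P>(\<omega> in M. \<bar>\<eta> \<omega>\<bar> > x) \<le> exp (- C1 * x powr m * L x)"
    have "\<exists>C>0. \<forall>x\<ge>2. \<P>(\<omega> in M. \<bar>\<xi> \<omega> * \<eta> \<omega>\<bar> > x) \<ge> exp (- C * ?g x)"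
      using bds by (intro B[OF indep, of C2]) blast
    then show "\<exists>C3>0. \<forall>x\<ge>2. \<P>(\<omega> in M. \<bar>\<xi> \<omega> * \<eta> \<omega>\<bar> > x)
        \<ge> exp (- C3 * x powr (m / 2) * L (sqrt x))"
      by (simp only: mult.assoc)
  qed
qed

end
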